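(* Let $f:\mathbb{R}^n\to\mathbb{R}$ be continuously differentiable on $\mathbb{R}^n$ and strongly convex with unique minimizer $x^*$, and suppose that its gradient $g=\nabla f$ is Lipschitz continuous on $\mathbb{R}^n$, i.e. there is $L>0$ with $\|g(x)-g(y)\|\le L\|x-y\|$ for all $x,y\in\mathbb{R}^n$. Let $\{x_k\}_{k\ge0}$ be an infinite sequence generated from a starting point $x_0\in\mathbb{R}^n$ by the algorithm GM_AOS (cone) described in the context (with $g(x_k)\ne0$ for all $k$), with $\eta_{\max}<1$. Then there exists $\zeta\in(0,1)$ such that $$f(x_k)-f(x^* )\le\zeta^k\big(f(x_0)-f(x^* )\big)\quad\text{for each }k\ge0.$$
   Context: Notation: $\|\cdot\|$ is the Euclidean norm, $\|\cdot\|_\infty$ the max norm, $f_k=f(x_k)$, $g_k=g(x_k)=\nabla f(x_k)$, $s_{k-1}=x_k-x_{k-1}$, $y_{k-1}=g_k-g_{k-1}$. Parameters of the algorithm: $0<\lambda_{\min}<\lambda_{\max}$, $0\le\eta_{\min}\le\eta_{\max}\le 1$, $0<\sigma<1$, $\delta>0$, $\xi_1\ge1$, $\xi_2\ge 1$, $\xi_3>0$, $0<\bar\eta<0.1$, $0<c_1<c_2$, and positive numbers $\tau_k>0$. **Algorithm GM_AOS (cone).** Set $Q_0=1$, $C_0=f_0$. (The practical stopping test $\|g_k\|_\infty\le\varepsilon$ is disregarded, so that an infinite sequence is produced.) At iteration $k$: (A) Trial stepsize $\alpha_k^0$. If $k=0$: $\alpha_0^0=1$ if $|f_0|\le10^{-30}$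 and $\|x_0\|_\infty\le10^{-30}$; $\alpha_0^0=2|f_0|/\|g_0\|$ if $|f_0|>10^{-30}$ and $\|x_0\|_\infty\le10^{-30}$; $\alpha_0^0=\min\{1,\|x_0\|_\infty/\|g_0\|_\infty\}$ if $\|g_0\|_\infty<10^7$ and $\|x_0\|_\infty>10^{-30}$; $\alpha_0^0=\min\{1,\max\{1,\|x_0\|_\infty\}/\|g_0\|_\infty\}$ if $\|g_0\|_\infty\ge10^7$ and $\|x_0\|_\infty>10^{-30}$. If $k\ge1$: $\alpha_k^0=\max\{\min\{\hat\alpha_k,\lambda_{\max}\},\lambda_{\min}\}$, where $\hat\alpha_k$ is defined as follows. Let $\alpha_k^{BB_1}=\|s_{k-1}\|^2/(s_{k-1}^Ty_{k-1})$ and $\alpha_k^{BB_2}=s_{k-1}^Ty_{k-1}/\|y_{k-1}\|^2$, and $$\mu_k=\left|\frac{2(f_{k-1}-f_k+g_k^Ts_{k-1})}{s_{k-1}^Ty_{k-1}}-1\right|.$$ Condition (Q): $\mu_k\le c_1$ or $\max\{\mu_k,\mu_{k-1}\}\le c_2$. Conic quantities: $\Delta_k=(f_{k-1}-f_k)^2-(g_k^Ts_{k-1})(g_{k-1}^Ts_{k-1})$; when $\Delta_k>0$, $\rho_k=\sqrt{\Delta_k}$, $\gamma_k=\max\{\min\{\frac{-g_{k-1}^Ts_{k-1}}{\rho_k+f_{k-1}-f_k},2\},0.01\}$, $b_k=\max\{\min\{\frac{1-\gamma_k}{\gamma_kg_{k-1}^Ts_{k-1}},5000\},-5000\}\,g_{k-1}$,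 $v_{k-1}=\gamma_ks_{k-1}$, $r_{k-1}=\frac1{\gamma_k}\left(\gamma_kg_k-\frac1{\gamma_k}g_{k-1}\right)$; when moreover $v_{k-1}^Tr_{k-1}>0$, $D_k=\xi_1\frac{v_{k-1}^Tv_{k-1}}{v_{k-1}^Tr_{k-1}}I$ and $$B_k=D_k-\frac{D_kv_{k-1}v_{k-1}^TD_k}{v_{k-1}^TD_kv_{k-1}}+\frac{r_{k-1}r_{k-1}^T}{v_{k-1}^Tr_{k-1}}.$$ Condition (C): $\Delta_k>0$, $v_{k-1}^Tr_{k-1}>0$ and $g_k^TB_kg_k+(g_k^Tg_k)(b_k^Tg_k)>0$. Convention: a condition (or alternative in a condition) involving an undefined quantity (zero denominator, or $\mu_0$) is regarded as not holding. - Case 1: (Q) does not hold and (C) holds. Put $\alpha_k^S=\dfrac{g_k^Tg_k}{g_k^TB_kg_k+(g_k^Tg_k)(b_k^Tg_k)}$. Then $\hat\alpha_k=\max\{\min\{\alpha_k^S,\alpha_k^{BB_1}\},\alpha_k^{BB_2}\}$ if $s_{k-1}^Ty_{k-1}>0$, and $\hat\alpha_k=\alpha_k^S$ otherwise. - Case 2: Case 1 does not apply and $s_{k-1}^Ty_{k-1}>0$. Put $\bar r_k=\min\{\max\{3(g_k+g_{k-1})^Ts_{k-1}+6(f_{k-1}-f_k),-\bar\eta s_{k-1}^Ty_{k-1}\},\bar\eta s_{k-1}^Ty_{k-1}\}$, $\tilde y_{k-1}=y_{k-1}+\frac{\bar r_k}{\|s_{k-1}\|^2}s_{k-1}$, $\tilde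 D_k=\xi_2\frac{y_{k-1}^Ty_{k-1}}{s_{k-1}^Ty_{k-1}}I$, $\tilde B_k=\tilde D_k-\frac{\tilde D_ks_{k-1}s_{k-1}^T\tilde D_k}{s_{k-1}^T\tilde D_ks_{k-1}}+\frac{\tilde y_{k-1}\tilde y_{k-1}^T}{s_{k-1}^T\tilde y_{k-1}}$. Then $\hat\alpha_k=\max\left\{\min\left\{\frac{g_k^Tg_k}{g_k^T\tilde B_kg_k},\alpha_k^{BB_1}\right\},\alpha_k^{BB_2}\right\}$. - Case 3: Case 1 does not apply and $s_{k-1}^Ty_{k-1}\le0$. Put $h_k=g_k^T\big(g(x_k-\tau_kg_k)-g(x_k)\big)/\tau_k$. Then $\hat\alpha_k=\frac{g_k^Tg_k}{|h_k|}$ if $\frac{\|g_{k-1}\|^2}{\|g_k\|^2}<\xi_3$ and $h_k\ne0$; $\hat\alpha_k=\frac{\|g_k\|^2}{|s_{k-1}^Ty_{k-1}|}\alpha_{k-1}^2$ if $\frac{\|g_{k-1}\|^2}{\|g_k\|^2}\ge\xi_3$ and $s_{k-1}^Ty_{k-1}\ne0$; $\hat\alpha_k=\delta\alpha_{k-1}$ otherwise. (B) Nonmonotone (Zhang–Hager) line search. Start with $\alpha=\alpha_k^0$. While $f(x_k-\alpha g_k)\le C_k-\sigma\alpha\|g_k\|^2$ fails, replace $\alpha$ by $\bar\alpha$ if $\alpha>0.1\alpha_k^0$ and $\bar\alpha\in[0.1\alpha_k^0,0.9\alpha]$, and by $0.5\alpha$ otherwise, where $\bar\alpha$ is the minimizer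 of the quadratic $q$ with $q(0)=f_k$, $q'(0)=-\|g_k\|^2$, $q(\alpha)=f(x_k-\alpha g_k)$. When the inequality holds, set $\alpha_k=\alpha$ and $x_{k+1}=x_k-\alpha_kg_k$. (C') Choose $\eta_k\in[\eta_{\min},\eta_{\max}]$ and set $Q_{k+1}=\eta_kQ_k+1$, $C_{k+1}=(\eta_kQ_kC_k+f(x_{k+1}))/Q_{k+1}$. *)

theory Defs
  imports "HOL-Analysis.Analysis"
begin

definition strongly_convex :: "('a::real_inner \<Rightarrow> real) \<Rightarrow> bool" where
  "strongly_convex f \<longleftrightarrow>
     (\<exists>m>0. \<forall>x y. \<forall>t\<in>{0..1}.
        f (t *\<^sub>R x + (1 - t) *\<^sub>R y)
          \<le> t * f x + (1 - t) * f y - m / 2 * t * (1 - t) * (norm (x - y))\<^sup>2)"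

definition unique_minimizer :: "('a \<Rightarrow> real) \<Rightarrow> 'a \<Rightarrow> bool" where
  "unique_minimizer f z \<longleftrightarrow>
     is_arg_min f (\<lambda>_. True) z \<and> (\<forall>w. is_arg_min f (\<lambda>_. True) w \<longrightarrow> w = z)"

record gm_params =
  par_lambda_min :: real
  par_lambda_max :: real
  par_eta_min :: real
  par_eta_max :: real
  par_sigma :: real
  par_delta :: real
  par_xi1 :: real
  par_xi2 :: real
  par_xi3 :: real
  par_eta_bar :: real
  par_c1 :: real
  par_c2 :: real
  par_tau :: "nat \<Rightarrow> real"

definition valid_params :: "gm_params \<Rightarrow> bool" where
  "valid_params p \<longleftrightarrow>
     0 < par_lambda_min p \<and> par_lambda_min p < par_lambda_max p \<and>
     0 \<le> par_eta_min p \<and> par_eta_min p \<le> par_eta_max p \<and> par_eta_max p \<le> 1 \<and>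
     0 < par_sigma p \<and> par_sigma p < 1 \<and>
     0 < par_delta p \<and>
     1 \<le> par_xi1 p \<and> 1 \<le> par_xi2 p \<and> 0 < par_xi3 p \<and>
     0 < par_eta_bar p \<and> par_eta_bar p < 0.1 \<and>
     0 < par_c1 p \<and> par_c1 p < par_c2 p \<and>
     (\<forall>k. 0 < par_tau p k)"

definition outer :: "real^'n \<Rightarrow> real^'n \<Rightarrow> real^'n^'n" where
  "outer u w = (\<chi> i j. u $ i * w $ j)"

definition bfgs :: "real^'n^'n \<Rightarrow> real^'n \<Rightarrow> real^'n \<Rightarrow> real^'n^'n" where
  "bfgs D s y = D - (1 / (s \<bullet> (D *v s))) *\<^sub>R (D ** outer s s ** D)
                  + (1 / (s \<bullet> y)) *\<^sub>R outer y y"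


text \<open>In the following definitions \<open>k\<close> is the current iteration, and \<open>s_prev x k\<close>,
  \<open>y_prev g x k\<close>, \<open>v_prev f g x k\<close> and \<open>r_prev f g x k\<close> are the vectors with index \<open>k - 1\<close>.
  They, and everything built from them, are meant for \<open>k \<ge> 1\<close> only.\<close>

context
  fixes p :: gm_params
    and f :: "real^'n \<Rightarrow> real"
    and g :: "real^'n \<Rightarrow> real^'n"
    and x :: "nat \<Rightarrow> real^'n"
begin

definition s_prev :: "nat \<Rightarrow> real^'n" where
  "s_prev k = x k - x (k - 1)"

definition y_prev :: "nat \<Rightarrow> real^'n" where
  "y_prev k = g (x k) - g (x (k - 1))"

definition alpha_BB1 :: "nat \<Rightarrow> real" where
  "alpha_BB1 k = (norm (s_prev k))\<^sup>2 / (s_prev k \<bullet> y_prev k)"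

definition alpha_BB2 :: "nat \<Rightarrow> real" where
  "alpha_BB2 k = (s_prev k \<bullet> y_prev k) / (norm (y_prev k))\<^sup>2"

definition mu :: "nat \<Rightarrow> real" where
  "mu k = \<bar>2 * (f (x (k - 1)) - f (x k) + g (x k) \<bullet> s_prev k) / (s_prev k \<bullet> y_prev k) - 1\<bar>"

definition mu_defined :: "nat \<Rightarrow> bool" where
  "mu_defined k \<longleftrightarrow> k \<ge> 1 \<and> s_prev k \<bullet> y_prev k \<noteq> 0"

definition cond_Q :: "nat \<Rightarrow> bool" where
  "cond_Q k \<longleftrightarrow>
     mu_defined k \<and> mu k \<le> par_c1 p \<or>
     mu_defined k \<and> mu_defined (k - 1) \<and> max (mu k) (mu (k - 1)) \<le> par_c2 p"

definition Delta :: "nat \<Rightarrow> real" where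
  "Delta k = (f (x (k - 1)) - f (x k))\<^sup>2 - (g (x k) \<bullet> s_prev k) * (g (x (k - 1)) \<bullet> s_prev k)"

definition rho :: "nat \<Rightarrow> real" where
  "rho k = sqrt (Delta k)"

definition cone_gamma :: "nat \<Rightarrow> real" where
  "cone_gamma k =
     max (min (- (g (x (k - 1)) \<bullet> s_prev k) / (rho k + f (x (k - 1)) - f (x k))) 2) 0.01"

definition b_vec :: "nat \<Rightarrow> real^'n" where
  "b_vec k =
     max (min ((1 - cone_gamma k) / (cone_gamma k * (g (x (k - 1)) \<bullet> s_prev k))) 5000) (- 5000)
       *\<^sub>R g (x (k - 1))"

definition v_prev :: "nat \<Rightarrow> real^'n" where
  "v_prev k = cone_gamma k *\<^sub>R s_prev k"

definition r_prev :: "nat \<Rightarrow> real^'n" where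
  "r_prev k = (1 / cone_gamma k) *\<^sub>R
     (cone_gamma k *\<^sub>R g (x k) - (1 / cone_gamma k) *\<^sub>R g (x (k - 1)))"

definition D_mat :: "nat \<Rightarrow> real^'n^'n" where
  "D_mat k = (par_xi1 p * (v_prev k \<bullet> v_prev k) / (v_prev k \<bullet> r_prev k)) *\<^sub>R mat 1"

definition B_mat :: "nat \<Rightarrow> real^'n^'n" where
  "B_mat k = bfgs (D_mat k) (v_prev k) (r_prev k)"

definition cone_denom :: "nat \<Rightarrow> real" where
  "cone_denom k =
     g (x k) \<bullet> (B_mat k *v g (x k)) + (g (x k) \<bullet> g (x k)) * (b_vec k \<bullet> g (x k))"

text \<open>The two disequalities say that \<open>cone_gamma k\<close> and \<open>b_vec k\<close> are defined; all other
  denominators are nonzero when \<open>v_prev k \<bullet> r_prev k > 0\<close> (and \<open>par_xi1 p \<ge> 1\<close>).\<close>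

definition cond_C :: "nat \<Rightarrow> bool" where
  "cond_C k \<longleftrightarrow>
     Delta k > 0 \<and>
     rho k + f (x (k - 1)) - f (x k) \<noteq> 0 \<and>
     cone_gamma k * (g (x (k - 1)) \<bullet> s_prev k) \<noteq> 0 \<and>
     v_prev k \<bullet> r_prev k > 0 \<and>
     cone_denom k > 0"

definition alpha_S :: "nat \<Rightarrow> real" where
  "alpha_S k = (g (x k) \<bullet> g (x k)) / cone_denom k"

definition r_bar :: "nat \<Rightarrow> real" where
  "r_bar k =
     min (max (3 * ((g (x k) + g (x (k - 1))) \<bullet> s_prev k) + 6 * (f (x (k - 1)) - f (x k)))
              (- par_eta_bar p * (s_prev k \<bullet> y_prev k)))
         (par_eta_bar p * (s_prev k \<bullet> y_prev k))"

definition y_tilde :: "nat \<Rightarrow> real^'n" where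
  "y_tilde k = y_prev k + (r_bar k / (norm (s_prev k))\<^sup>2) *\<^sub>R s_prev k"

definition D_tilde :: "nat \<Rightarrow> real^'n^'n" where
  "D_tilde k = (par_xi2 p * (y_prev k \<bullet> y_prev k) / (s_prev k \<bullet> y_prev k)) *\<^sub>R mat 1"

definition B_tilde :: "nat \<Rightarrow> real^'n^'n" where
  "B_tilde k = bfgs (D_tilde k) (s_prev k) (y_tilde k)"

definition h_diff :: "nat \<Rightarrow> real" where
  "h_diff k = g (x k) \<bullet> (g (x k - par_tau p k *\<^sub>R g (x k)) - g (x k)) / par_tau p k"

text \<open>The argument \<open>a\<close> is the previous stepsize.\<close>

definition alpha_hat :: "real \<Rightarrow> nat \<Rightarrow> real" where
  "alpha_hat a k =
    (let sy = s_prev k \<bullet> y_prev k;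
         ratio = (norm (g (x (k - 1))))\<^sup>2 / (norm (g (x k)))\<^sup>2
     in
       if \<not> cond_Q k \<and> cond_C k then
         (if sy > 0 then max (min (alpha_S k) (alpha_BB1 k)) (alpha_BB2 k) else alpha_S k)
       else if sy > 0 then
         max (min ((g (x k) \<bullet> g (x k)) / (g (x k) \<bullet> (B_tilde k *v g (x k)))) (alpha_BB1 k))
             (alpha_BB2 k)
       else if ratio < par_xi3 p \<and> h_diff k \<noteq> 0 then
         (g (x k) \<bullet> g (x k)) / \<bar>h_diff k\<bar>
       else if ratio \<ge> par_xi3 p \<and> sy \<noteq> 0 then
         (norm (g (x k)))\<^sup>2 / \<bar>sy\<bar> * a\<^sup>2
       else par_delta p * a)"

definition initial_trial_step :: real where
  "initial_trial_step =
     (if infnorm (x 0) \<le> 1 / 10^30 then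
        (if \<bar>f (x 0)\<bar> \<le> 1 / 10^30 then 1 else 2 * \<bar>f (x 0)\<bar> / norm (g (x 0)))
      else if infnorm (g (x 0)) < 10^7 then
        min 1 (infnorm (x 0) / infnorm (g (x 0)))
      else
        min 1 (max 1 (infnorm (x 0)) / infnorm (g (x 0))))"

definition trial_step :: "(nat \<Rightarrow> real) \<Rightarrow> nat \<Rightarrow> real" where
  "trial_step \<alpha> k =
     (if k = 0 then initial_trial_step
      else max (min (alpha_hat (\<alpha> (k - 1)) k) (par_lambda_max p)) (par_lambda_min p))"

end


text \<open>\<open>t\<close> is a minimizer of the quadratic interpolant with value \<open>q0\<close> and derivative \<open>d0\<close> at \<open>0\<close>
  and value \<open>q1\<close> at \<open>a\<close>; no \<open>t\<close> qualifies if that quadratic has no minimizer.\<close>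

definition quad_interp_minimizer :: "real \<Rightarrow> real \<Rightarrow> real \<Rightarrow> real \<Rightarrow> real \<Rightarrow> bool" where
  "quad_interp_minimizer q0 d0 a q1 t \<longleftrightarrow>
     (\<exists>q u v w. q = (\<lambda>z. u * z\<^sup>2 + v * z + w) \<and>
        q 0 = q0 \<and> (q has_real_derivative d0) (at 0) \<and> q a = q1 \<and>
        is_arg_min q (\<lambda>_. True) t)"

definition armijo :: "('a::real_inner \<Rightarrow> real) \<Rightarrow> real \<Rightarrow> real \<Rightarrow> 'a \<Rightarrow> 'a \<Rightarrow> real \<Rightarrow> bool" where
  "armijo f \<sigma> c z d a \<longleftrightarrow> f (z - a *\<^sub>R d) \<le> c - \<sigma> * a * (norm d)\<^sup>2"

definition interp_step_ok :: "('a::real_inner \<Rightarrow> real) \<Rightarrow> 'a \<Rightarrow> 'a \<Rightarrow> real \<Rightarrow> real \<Rightarrow> real \<Rightarrow> bool" where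
  "interp_step_ok f z d a0 a t \<longleftrightarrow>
     a > 0.1 * a0 \<and>
     quad_interp_minimizer (f z) (- (norm d)\<^sup>2) a (f (z - a *\<^sub>R d)) t \<and>
     t \<in> {0.1 * a0 .. 0.9 * a}"

text \<open>\<open>line_search f \<sigma> c z d a0 a b\<close>: the backtracking loop at the point \<open>z\<close> with gradient \<open>d\<close>,
  reference value \<open>c\<close> and initial trial stepsize \<open>a0\<close>, continued from the current stepsize \<open>a\<close>,
  terminates with the stepsize \<open>b\<close>.\<close>

inductive line_search ::
  "('a::real_inner \<Rightarrow> real) \<Rightarrow> real \<Rightarrow> real \<Rightarrow> 'a \<Rightarrow> 'a \<Rightarrow> real \<Rightarrow> real \<Rightarrow> real \<Rightarrow> bool"
  for f \<sigma> c z d a0 where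
  accept: "armijo f \<sigma> c z d a \<Longrightarrow> line_search f \<sigma> c z d a0 a a"
| interpolate: "\<not> armijo f \<sigma> c z d a \<Longrightarrow> interp_step_ok f z d a0 a t \<Longrightarrow>
    line_search f \<sigma> c z d a0 t b \<Longrightarrow> line_search f \<sigma> c z d a0 a b"
| halve: "\<not> armijo f \<sigma> c z d a \<Longrightarrow> (\<nexists>t. interp_step_ok f z d a0 a t) \<Longrightarrow>
    line_search f \<sigma> c z d a0 (0.5 * a) b \<Longrightarrow> line_search f \<sigma> c z d a0 a b"

text \<open>\<open>g\<close> is the gradient of \<open>f\<close>; this is not part of the definition.\<close>

definition GM_AOS_cone ::
  "gm_params \<Rightarrow> (real^'n \<Rightarrow> real) \<Rightarrow> (real^'n \<Rightarrow> real^'n) \<Rightarrow> (nat \<Rightarrow> real^'n) \<Rightarrow> bool" where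
  "GM_AOS_cone p f g x \<longleftrightarrow>
     (\<exists>(\<alpha>::nat \<Rightarrow> real) (\<eta>::nat \<Rightarrow> real) (Q::nat \<Rightarrow> real) (C::nat \<Rightarrow> real).
        Q 0 = 1 \<and> C 0 = f (x 0) \<and>
        (\<forall>k. line_search f (par_sigma p) (C k) (x k) (g (x k))
               (trial_step p f g x \<alpha> k) (trial_step p f g x \<alpha> k) (\<alpha> k) \<and>
             x (Suc k) = x k - \<alpha> k *\<^sub>R g (x k) \<and>
             \<eta> k \<in> {par_eta_min p .. par_eta_max p} \<and>
             Q (Suc k) = \<eta> k * Q k + 1 \<and>
             C (Suc k) = (\<eta> k * Q k * C k + f (x (Suc k))) / Q (Suc k)))"

end

theory Submission
  imports Defs
begin

text \<open>The stepsizes lie in an interval \<open>[a, A]\<close> with \<open>a > 0\<close>: apart from \<open>k = 0\<close>, the trial step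
  lies in \<open>[\<lambda>\<^sub>m\<^sub>i\<^sub>n, \<lambda>\<^sub>m\<^sub>a\<^sub>x]\<close> by truncation, whatever the formula behind it, and a rejected
  stepsize exceeds \<open>(1 - \<sigma>) / L\<close>. Hence \<open>C\<^sub>k - f (x\<^sub>k\<^sub>+\<^sub>1) \<ge> \<sigma> a \<parallel>g\<^sub>k\<parallel>\<^sup>2\<close>. Strong convexity gives
  \<open>f (x\<^sub>k\<^sub>+\<^sub>1) - f (x\<^sup>*) \<le> \<parallel>g\<^sub>k\<^sub>+\<^sub>1\<parallel>\<^sup>2 / (2 m)\<close>, and \<open>\<parallel>g\<^sub>k\<^sub>+\<^sub>1\<parallel> \<le> (1 + L A) \<parallel>g\<^sub>k\<parallel>\<close>, so this
  decrease is a fixed fraction of \<open>C\<^sub>k - f (x\<^sup>*)\<close>. As \<open>Q\<^sub>k \<le> 1 / (1 - \<eta>\<^sub>m\<^sub>a\<^sub>x)\<close>, the averages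
  \<open>C\<^sub>k \<ge> f (x\<^sub>k)\<close> themselves decrease linearly towards \<open>f (x\<^sup>*)\<close>, starting from \<open>C\<^sub>0 = f (x\<^sub>0)\<close>.\<close>

section \<open>Strong convexity and Lipschitz gradients\<close>

lemma has_real_derivative_along_line:
  assumes "\<And>z. GDERIV f z :> g z"
  shows "((\<lambda>t. f (z + t *\<^sub>R d)) has_real_derivative g (z + t *\<^sub>R d) \<bullet> d) (at t)"
proof -
  have "((\<lambda>t. z + t *\<^sub>R d) has_derivative (\<lambda>h. h *\<^sub>R d)) (at t)"
    by (auto intro!: derivative_eq_intros)
  moreover have "(f has_derivative (\<lambda>h. h \<bullet> g (z + t *\<^sub>R d))) (at (z + t *\<^sub>R d))"
    using assms by (simp add: gderiv_def)
  ultimately have "((\<lambda>t. f (z + t *\<^sub>R d)) has_derivative (\<lambda>h. (h *\<^sub>R d) \<bullet> g (z + t *\<^sub>R d))) (at t)"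
    by (rule has_derivative_compose)
  then show ?thesis
    by (simp add: has_field_derivative_def inner_commute mult.commute[of _ "g _ \<bullet> d"] mult_commute_abs)
qed

text \<open>The Polyak-Lojasiewicz inequality, obtained by letting the difference quotient of
  \<open>f\<close> along the segment from \<open>z\<close> to \<open>y\<close> tend to the
  directional derivative at \<open>z\<close>.\<close>

lemma strongly_convex_gradient_bound:
  assumes grad: "\<And>z. GDERIV f z :> g z" and "strongly_convex f"
  obtains m where "m > 0" "\<And>y z. f z - f y \<le> (norm (g z))\<^sup>2 / (2 * m)"
proof -
  obtain m where m: "m > 0"
    and conv: "\<And>y z t. t \<in> {0..1} \<Longrightarrow> f (t *\<^sub>R y + (1 - t) *\<^sub>R z)
          \<le> t * f y + (1 - t) * f z - m / 2 * t * (1 - t) * (norm (y - z))\<^sup>2"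
    using \<open>strongly_convex f\<close> unfolding strongly_convex_def by metis
  have "f z - f y \<le> (norm (g z))\<^sup>2 / (2 * m)" for y z
  proof -
    let ?q = "\<lambda>t. (f (z + t *\<^sub>R (y - z)) - f z) / t"
    let ?u = "\<lambda>t. f y - f z - m / 2 * (1 - t) * (norm (y - z))\<^sup>2"
    have "(?q \<longlongrightarrow> g z \<bullet> (y - z)) (at 0)"
      using has_real_derivative_along_line[OF grad, of z "y - z" 0] by (simp add: DERIV_def)
    then have q: "(?q \<longlongrightarrow> g z \<bullet> (y - z)) (at_right 0)"
      by (rule tendsto_mono[rotated]) (simp add: at_le)
    have "(?u \<longlongrightarrow> ?u 0) (at_right 0)"
      by (intro tendsto_intros)
    moreover have "eventually (\<lambda>t. ?q t \<le> ?u t) (at_right 0)"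
    proof -
      have "?q t \<le> ?u t" if "t \<in> {0<..<1}" for t
      proof -
        have "z + t *\<^sub>R (y - z) = t *\<^sub>R y + (1 - t) *\<^sub>R z"
          by (simp add: algebra_simps)
        then have "f (z + t *\<^sub>R (y - z)) - f z \<le> ?u t * t"
          using conv[of t y z] that by (simp add: algebra_simps)
        then show ?thesis
          using that by (simp add: pos_divide_le_eq)
      qed
      then show ?thesis
        by (intro eventually_at_rightI[of 0 1]) auto
    qed
    ultimately have "g z \<bullet> (y - z) \<le> ?u 0"
      using q by (intro tendsto_le[of "at_right 0" ?u _ ?q]) auto
    \<comment> \<open>Completing the square removes the unknown distance from \<open>y\<close> to
      \<open>z\<close>.\<close>
    moreover have "(norm (g z))\<^sup>2 + 2 * m * (g z \<bullet> (y - z)) + m\<^sup>2 * (norm (y - z))\<^sup>2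
        = (norm (g z + m *\<^sub>R (y - z)))\<^sup>2"
      using dot_norm[of "g z" "m *\<^sub>R (y - z)"] by (simp add: power_mult_distrib)
    then have "0 \<le> (norm (g z))\<^sup>2 + 2 * m * (g z \<bullet> (y - z)) + m\<^sup>2 * (norm (y - z))\<^sup>2"
      by simp
    then have "- (g z \<bullet> (y - z)) - m / 2 * (norm (y - z))\<^sup>2 \<le> (norm (g z))\<^sup>2 / (2 * m)"
      using m by (simp add: field_simps power2_eq_square)
    ultimately show ?thesis
      by simp
  qed
  with m show thesis
    by (rule that)
qed

text \<open>The mean value theorem and the Lipschitz bound at the intermediate point give the factor
  \<open>1 - L * a\<close>; integrating would give \<open>1 - L * a / 2\<close>, but only the
  constants would improve.\<close>

lemma gradient_step_decrease:
  fixes f :: "'a::real_inner \<Rightarrow> real"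
  assumes grad: "\<And>z. GDERIV f z :> g z" and lip: "L-lipschitz_on UNIV g" and "a \<ge> 0"
  shows "f (z - a *\<^sub>R g z) \<le> f z - a * (1 - L * a) * (norm (g z))\<^sup>2"
proof (cases "a = 0")
  case False
  then have "a > 0"
    using \<open>a \<ge> 0\<close> by simp
  obtain b where b: "0 < b" "b < a"
    and mvt: "f (z + a *\<^sub>R (- g z)) - f (z + 0 *\<^sub>R (- g z)) = (a - 0) * (g (z + b *\<^sub>R (- g z)) \<bullet> (- g z))"
    using MVT2[OF \<open>a > 0\<close> has_real_derivative_along_line[OF grad, of z "- g z"]] by blast
  let ?w = "z + b *\<^sub>R (- g z)"
  have L: "L \<ge> 0"
    using lip by (rule lipschitz_on_nonneg)
  have "norm (g z - g ?w) \<le> L * (b * norm (g z))"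
    using lipschitz_onD[OF lip, of z ?w] b by (simp add: dist_norm)
  also have "\<dots> \<le> L * (a * norm (g z))"
    using b L by (intro mult_left_mono mult_right_mono) auto
  finally have "norm (g z - g ?w) * norm (g z) \<le> L * (a * norm (g z)) * norm (g z)"
    by (intro mult_right_mono) auto
  then have "(g z - g ?w) \<bullet> g z \<le> L * a * (norm (g z))\<^sup>2"
    using norm_cauchy_schwarz[of "g z - g ?w" "g z"] by (simp add: power2_eq_square mult.assoc)
  then have "(1 - L * a) * (norm (g z))\<^sup>2 \<le> g ?w \<bullet> g z"
    by (simp add: inner_diff_left power2_norm_eq_inner algebra_simps)
  then have "a * ((1 - L * a) * (norm (g z))\<^sup>2) \<le> a * (g ?w \<bullet> g z)"
    using \<open>a > 0\<close> by simp
  then show ?thesis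
    using mvt by (simp add: mult.assoc)
qed simp

section \<open>Stepsize bounds\<close>

lemma line_search_armijo:
  "line_search f \<sigma> c z d a0 a b \<Longrightarrow> armijo f \<sigma> c z d b"
  by (induction rule: line_search.induct)

text \<open>The bound \<open>l \<le> a\<close> is a loop invariant: interpolation stays above a
  tenth of \<open>a0\<close>, and halving happens only after a rejection, which forces the stepsize
  above \<open>(1 - \<sigma>) / L\<close>.\<close>

lemma line_search_step_bounds:
  fixes f :: "'a::real_inner \<Rightarrow> real"
  assumes "line_search f \<sigma> c z (g z) a0 a b"
    and grad: "\<And>z. GDERIV f z :> g z" and lip: "L-lipschitz_on UNIV g" and "L > 0"
    and "f z \<le> c" and l: "0 < l" "l \<le> a0 / 10" "l \<le> (1 - \<sigma>) / (2 * L)" "l \<le> a"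
  shows "b \<in> {l..a}"
  using assms(1) l(4)
proof (induction rule: line_search.induct)
  case (accept a)
  then show ?case
    by simp
next
  case (interpolate a t b)
  then have "t \<in> {0.1 * a0 .. 0.9 * a}"
    by (simp add: interp_step_ok_def)
  with interpolate l show ?case
    by auto
next
  case (halve a b)
  then have "a > 0"
    using l by simp
  \<comment> \<open>As \<open>f z \<le> c\<close>, failing the nonmonotone test implies failing the
    ordinary Armijo test.\<close>
  have "f (z - a *\<^sub>R g z) > f z - \<sigma> * a * (norm (g z))\<^sup>2"
    using halve \<open>f z \<le> c\<close> by (simp add: armijo_def)
  then have "a * (norm (g z))\<^sup>2 * (1 - L * a) < a * (norm (g z))\<^sup>2 * \<sigma>"
    using gradient_step_decrease[OF grad lip, of a z] \<open>a > 0\<close> by (simp add: algebra_simps)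
  then have "1 - L * a < \<sigma>"
    by (rule mult_left_less_imp_less) (use \<open>a > 0\<close> in auto)
  then have "(1 - \<sigma>) / (2 * L) \<le> 0.5 * a"
    using \<open>L > 0\<close> by (simp add: field_simps)
  with halve l \<open>a > 0\<close> show ?case
    by auto
qed

text \<open>The first trial step is not truncated, so its positivity is checked case by case; the
  positive thresholds keep the numerators away from zero.\<close>

lemma initial_trial_step_pos:
  assumes "g (x 0) \<noteq> 0"
  shows "initial_trial_step f g x > 0"
proof -
  have "(0::real) < 1 / 10 ^ 30"
    by simp
  then have "\<not> infnorm (x 0) \<le> 1 / 10 ^ 30 \<Longrightarrow> 0 < infnorm (x 0)"
    "\<not> \<bar>f (x 0)\<bar> \<le> 1 / 10 ^ 30 \<Longrightarrow> 0 < \<bar>f (x 0)\<bar>"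
    by linarith+
  moreover have "0 < infnorm (g (x 0))"
    using assms by (simp add: infnorm_pos_lt)
  ultimately show ?thesis
    using assms unfolding initial_trial_step_def by (auto simp del: power_one_over)
qed

lemma trial_step_bounds:
  assumes "valid_params p"
  shows "trial_step p f g x \<alpha> k \<in> {min (initial_trial_step f g x) (par_lambda_min p)
           .. max (initial_trial_step f g x) (par_lambda_max p)}"
  using assms by (auto simp: trial_step_def valid_params_def)

section \<open>Zhang-Hager averages\<close>

locale nonmonotone_average =
  fixes \<eta> Q C F :: "nat \<Rightarrow> real" and \<eta>max :: real
  assumes Q0: "Q 0 = 1" and C0: "C 0 = F 0"
    and eta: "\<And>k. 0 \<le> \<eta> k" "\<And>k. \<eta> k \<le> \<eta>max" and eta_max: "\<eta>max < 1"
    and Q_Suc: "\<And>k. Q (Suc k) = \<eta> k * Q k + 1"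
    and C_Suc: "\<And>k. C (Suc k) = (\<eta> k * Q k * C k + F (Suc k)) / Q (Suc k)"
begin

text \<open>\<open>Q k\<close> is dominated by the geometric series with ratio
  \<open>\<eta>max\<close>.\<close>

lemma Q_bounds: "1 \<le> Q k \<and> Q k * (1 - \<eta>max) \<le> 1"
proof (induction k)
  case 0
  have "0 \<le> \<eta>max"
    using eta[of 0] by linarith
  with Q0 show ?case
    by simp
next
  case (Suc k)
  have "\<eta> k * Q k \<le> \<eta>max * Q k"
    using eta Suc by (intro mult_right_mono) auto
  then have "Q (Suc k) * (1 - \<eta>max) \<le> (\<eta>max * Q k + 1) * (1 - \<eta>max)"
    unfolding Q_Suc using eta_max by (intro mult_right_mono) auto
  also have "\<dots> = \<eta>max * (Q k * (1 - \<eta>max)) + (1 - \<eta>max)"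
    by (simp add: algebra_simps)
  also have "\<dots> \<le> \<eta>max * 1 + (1 - \<eta>max)"
    using Suc eta[of k] by (intro add_right_mono mult_left_mono) auto
  finally show ?case
    using eta[of k] Suc by (simp add: Q_Suc)
qed

text \<open>Since \<open>\<eta> k * Q k = Q (Suc k) - 1\<close>, the new average is a convex
  combination in which \<open>F (Suc k)\<close> has weight \<open>1 / Q (Suc k)\<close>. The next
  two lemmas use that this weight is at most 1 and at least \<open>1 - \<eta>max\<close>.\<close>

lemma C_Suc_eq: "C (Suc k) = C k - (C k - F (Suc k)) / Q (Suc k)"
proof -
  have "Q (Suc k) > 0"
    using Q_bounds[of "Suc k"] by linarith
  moreover have "C (Suc k) = ((Q (Suc k) - 1) * C k + F (Suc k)) / Q (Suc k)"
    unfolding C_Suc by (simp add: Q_Suc)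
  ultimately show ?thesis
    by (simp add: field_simps)
qed

lemma F_le_C_Suc:
  assumes "F (Suc k) \<le> C k"
  shows "F (Suc k) \<le> C (Suc k)"
proof -
  have "(C k - F (Suc k)) / Q (Suc k) \<le> C k - F (Suc k)"
    using assms Q_bounds[of "Suc k"] by (simp add: divide_le_eq mult_le_cancel_left1)
  then show ?thesis
    by (simp add: C_Suc_eq)
qed

lemma C_Suc_le:
  assumes "F (Suc k) \<le> C k"
  shows "C (Suc k) \<le> C k - (1 - \<eta>max) * (C k - F (Suc k))"
proof -
  have "Q (Suc k) > 0" "1 - \<eta>max \<le> 1 / Q (Suc k)"
    using Q_bounds[of "Suc k"] by (auto simp: field_simps)
  then have "(1 - \<eta>max) * (C k - F (Suc k)) \<le> 1 / Q (Suc k) * (C k - F (Suc k))"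
    using assms by (intro mult_right_mono) auto
  then show ?thesis
    by (simp add: C_Suc_eq)
qed

lemma linear_convergence:
  assumes \<kappa>: "0 < \<kappa>" "\<kappa> < 1" and lower: "\<And>k. Fstar \<le> F k"
    and decrease: "\<And>k. F k \<le> C k \<Longrightarrow> \<kappa> * (C k - Fstar) \<le> C k - F (Suc k)"
  shows "F k - Fstar \<le> (1 - (1 - \<eta>max) * \<kappa>) ^ k * (F 0 - Fstar)"
proof -
  let ?\<zeta> = "1 - (1 - \<eta>max) * \<kappa>"
  have "0 \<le> \<eta>max"
    using eta[of 0] by linarith
  then have "(1 - \<eta>max) * \<kappa> \<le> 1"
    using \<kappa> eta_max by (intro mult_le_one) auto
  then have \<zeta>: "0 \<le> ?\<zeta>"
    by simp
  \<comment> \<open>The rate is proved for \<open>C\<close>, since \<open>F\<close> itself need not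
    decrease; \<open>F k \<le> C k\<close> is carried along because \<open>decrease\<close> requires
    it.\<close>
  have "F k \<le> C k \<and> C k - Fstar \<le> ?\<zeta> ^ k * (F 0 - Fstar)"
  proof (induction k)
    case 0
    then show ?case
      by (simp add: C0)
  next
    case (Suc k)
    have dec: "\<kappa> * (C k - Fstar) \<le> C k - F (Suc k)"
      using decrease Suc by blast
    moreover have "0 \<le> \<kappa> * (C k - Fstar)"
      using \<kappa> lower[of k] Suc by simp
    ultimately have le: "F (Suc k) \<le> C k"
      by linarith
    have "(1 - \<eta>max) * (\<kappa> * (C k - Fstar)) \<le> (1 - \<eta>max) * (C k - F (Suc k))"
      using dec eta_max by simp
    then have "C (Suc k) - Fstar \<le> ?\<zeta> * (C k - Fstar)"
      using C_Suc_le[OF le] by (simp add: algebra_simps)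
    also have "\<dots> \<le> ?\<zeta> * (?\<zeta> ^ k * (F 0 - Fstar))"
      using Suc \<zeta> by (intro mult_left_mono) auto
    finally show ?case
      using F_le_C_Suc[OF le] by simp
  qed
  then show ?thesis
    by linarith
qed

end

section \<open>Linear rate of the algorithm\<close>

theorem theorem3p2:
  fixes f :: "real^'n \<Rightarrow> real"
    and g :: "real^'n \<Rightarrow> real^'n"
    and x :: "nat \<Rightarrow> real^'n"
    and xstar :: "real^'n"
    and L :: real
    and p :: gm_params
  assumes grad: "\<And>z. GDERIV f z :> g z"
    and grad_cont: "continuous_on UNIV g"
    and strong: "strongly_convex f"
    and minimizer: "unique_minimizer f xstar"
    and L_pos: "L > 0"
    and lipschitz: "L-lipschitz_on UNIV g"
    and params: "valid_params p"
    and eta_max_less_1: "par_eta_max p < 1"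
    and generated: "GM_AOS_cone p f g x"
    and grad_nonzero: "\<And>k. g (x k) \<noteq> 0"
  shows "\<exists>\<zeta>. 0 < \<zeta> \<and> \<zeta> < 1 \<and>
           (\<forall>k. f (x k) - f xstar \<le> \<zeta> ^ k * (f (x 0) - f xstar))"
proof -
  obtain \<alpha> \<eta> Q C where Q0: "Q 0 = 1" and C0: "C 0 = f (x 0)"
    and search: "\<And>k. line_search f (par_sigma p) (C k) (x k) (g (x k))
               (trial_step p f g x \<alpha> k) (trial_step p f g x \<alpha> k) (\<alpha> k)"
    and step: "\<And>k. x (Suc k) = x k - \<alpha> k *\<^sub>R g (x k)"
    and eta: "\<And>k. \<eta> k \<in> {par_eta_min p .. par_eta_max p}"
    and Q_Suc: "\<And>k. Q (Suc k) = \<eta> k * Q k + 1"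
    and C_Suc: "\<And>k. C (Suc k) = (\<eta> k * Q k * C k + f (x (Suc k))) / Q (Suc k)"
    using generated unfolding GM_AOS_cone_def by metis
  have par: "0 < par_lambda_min p" "0 \<le> par_eta_min p" "0 < par_sigma p" "par_sigma p < 1"
    using params by (auto simp: valid_params_def)
  interpret nonmonotone_average \<eta> Q C "\<lambda>k. f (x k)" "par_eta_max p"
  proof
    show "0 \<le> \<eta> k" "\<eta> k \<le> par_eta_max p" for k
      using eta[of k] par by auto
  qed (use Q0 C0 Q_Suc C_Suc eta_max_less_1 in auto)
  \<comment> \<open>The divisor 10 matches the interpolation floor, the last term the halving of a
    rejected step.\<close>
  define a where "a = min (min (initial_trial_step f g x) (par_lambda_min p) / 10)
                        ((1 - par_sigma p) / (2 * L))"
  define A where "A = max (initial_trial_step f g x) (par_lambda_max p)"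
  have init: "initial_trial_step f g x > 0"
    by (rule initial_trial_step_pos) (rule grad_nonzero)
  have a: "a > 0"
    using init par L_pos by (simp add: a_def)
  have A: "A > 0"
    using init by (simp add: A_def)
  have \<alpha>: "\<alpha> k \<in> {a..A}" if "f (x k) \<le> C k" for k
  proof -
    have t: "10 * a \<le> trial_step p f g x \<alpha> k" "trial_step p f g x \<alpha> k \<le> A"
      using trial_step_bounds[OF params, of f g x \<alpha> k] unfolding a_def A_def by auto
    with a have "\<alpha> k \<in> {a..trial_step p f g x \<alpha> k}"
      by (intro line_search_step_bounds[OF search grad lipschitz L_pos that]) (auto simp: a_def)
    with t show ?thesis
      by auto
  qed
  obtain m where m: "m > 0" "\<And>y z. f z - f y \<le> (norm (g z))\<^sup>2 / (2 * m)"
    using strongly_convex_gradient_bound[OF grad strong] by metis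
  define \<beta> where "\<beta> = (1 + L * A)\<^sup>2 / (2 * m)"
  \<comment> \<open>With \<open>?D\<close> the decrease \<open>C k - f (x (Suc k))\<close>, the
    remaining gap \<open>f (x (Suc k)) - f xstar\<close> is at most
    \<open>\<beta> / (par_sigma p * a)\<close> times \<open>?D\<close>. Adding \<open>?D\<close>
    bounds the whole gap \<open>C k - f xstar\<close>, and \<open>\<kappa>\<close> is the reciprocal
    of the resulting factor.\<close>
  define \<kappa> where "\<kappa> = 1 / (1 + \<beta> / (par_sigma p * a))"
  have "1 + L * A > 0"
    using L_pos A by (simp add: add_pos_pos)
  then have \<beta>: "\<beta> > 0"
    using m by (simp add: \<beta>_def)
  then have "\<beta> / (par_sigma p * a) > 0"
    using par a by simp
  then have \<kappa>: "0 < \<kappa>" "\<kappa> < 1"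
    by (auto simp: \<kappa>_def)
  have decrease: "\<kappa> * (C k - f xstar) \<le> C k - f (x (Suc k))" if "f (x k) \<le> C k" for k
  proof -
    let ?n = "norm (g (x k))" and ?D = "C k - f (x (Suc k))"
    have ak: "a \<le> \<alpha> k" "\<alpha> k \<le> A"
      using \<alpha>[OF that] by auto
    have "par_sigma p * a * ?n\<^sup>2 \<le> par_sigma p * \<alpha> k * ?n\<^sup>2"
      using ak par by (intro mult_right_mono mult_left_mono) auto
    also have "\<dots> \<le> ?D"
      using line_search_armijo[OF search, of k] by (simp add: armijo_def step)
    finally have D: "?n\<^sup>2 \<le> ?D / (par_sigma p * a)"
      using par a by (simp add: field_simps)
    have "norm (g (x (Suc k)) - g (x k)) \<le> L * (\<alpha> k * ?n)"
      using lipschitz_onD[OF lipschitz, of "x (Suc k)" "x k"] ak a by (simp add: dist_norm step)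
    also have "\<dots> \<le> L * (A * ?n)"
      using ak L_pos by (intro mult_left_mono mult_right_mono) auto
    finally have "norm (g (x (Suc k))) \<le> (1 + L * A) * ?n"
      using norm_triangle_ineq2[of "g (x (Suc k))" "g (x k)"] by (simp add: algebra_simps)
    then have "(norm (g (x (Suc k))))\<^sup>2 \<le> ((1 + L * A) * ?n)\<^sup>2"
      by (rule power_mono) simp
    then have "(norm (g (x (Suc k))))\<^sup>2 / (2 * m) \<le> \<beta> * ?n\<^sup>2"
      using m by (simp add: \<beta>_def power_mult_distrib divide_right_mono)
    then have "f (x (Suc k)) - f xstar \<le> \<beta> * ?n\<^sup>2"
      using m(2)[of "x (Suc k)" xstar] by linarith
    also have "\<dots> \<le> \<beta> * (?D / (par_sigma p * a))"
      using D \<beta> by (intro mult_left_mono) auto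
    finally have "C k - f xstar \<le> (1 + \<beta> / (par_sigma p * a)) * ?D"
      by (simp add: distrib_right)
    then have "\<kappa> * (C k - f xstar) \<le> \<kappa> * ((1 + \<beta> / (par_sigma p * a)) * ?D)"
      using \<kappa> by (intro mult_left_mono) auto
    also have "\<dots> = ?D"
      using \<open>\<beta> / (par_sigma p * a) > 0\<close> by (simp add: \<kappa>_def)
    finally show ?thesis .
  qed
  have lower: "f xstar \<le> f z" for z
    using minimizer by (auto simp: unique_minimizer_def is_arg_min_def not_less)
  have "0 \<le> par_eta_max p"
    using eta[of 0] par by auto
  \<comment> \<open>Together with \<open>\<kappa> < 1\<close> this keeps the rate strictly positive
    even when \<open>par_eta_max p = 0\<close>.\<close>
  then have "(1 - par_eta_max p) * \<kappa> \<le> \<kappa>"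
    using \<kappa> by (simp add: mult_le_cancel_right1)
  with \<kappa> have "0 < 1 - (1 - par_eta_max p) * \<kappa>"
    by linarith
  moreover have "1 - (1 - par_eta_max p) * \<kappa> < 1"
    using \<kappa> eta_max_less_1 by simp
  ultimately show ?thesis
    using linear_convergence[OF \<kappa> lower decrease] by blast
qed

end
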